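(* Let $\ell\colon\hat{\mathcal Y}\times\mathcal Y\to\mathbb R_{\ge0}$ be a target loss with decomposition $\ell(\hat y,y)=\langle\boldsymbol\rho(y),\boldsymbol\ell^{\boldsymbol\rho}(\hat y)\rangle+c(y)$ and $\min_{\hat y\in\hat{\mathcal Y}}\ell(\hat y,y)=0$ for all $y\in\mathcal Y$. Let $\Omega\colon\mathbb R^d\to\mathbb R\cup\{+\infty\}$ satisfy $\mathrm{dom}(\Omega)=\mathcal C$ and be $\lambda$-strongly convex over $\mathcal C$ with respect to the $\ell_2$-norm for some $\lambda>0$. Let $(\boldsymbol\theta,y)\in\mathbb R^d\times\mathcal Y$ and let $$\boldsymbol\pi(\boldsymbol\theta)\in\arg\min_{\boldsymbol\pi\in\triangle^N}\Omega^*(\boldsymbol\theta+\mathcal L^{\boldsymbol\rho}\boldsymbol\pi).$$ Draw $\hat y$ from $\hat{\mathcal Y}$ following $\boldsymbol\pi(\boldsymbol\theta)\in\triangle^N$. Then $$\mathbb E_{\hat y\sim\boldsymbol\pi(\boldsymbol\theta)}[\ell(\hat y,y)]=L_{\Omega_\tau}(\boldsymbol\theta,y)-L_\Omega(\boldsymbol\theta+\mathcal L^{\boldsymbol\rho}\boldsymbol\pi(\boldsymbol\theta),y).$$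
   Context: $\mathcal Y=[K]$ and $\hat{\mathcal Y}=[N]$ are finite sets of labels and predictions; $\triangle^N$ is the probability simplex over $\hat{\mathcal Y}$. In the decomposition of $\ell$, $\boldsymbol\rho\colon\mathcal Y\to\mathbb R^d$, $\boldsymbol\ell^{\boldsymbol\rho}\colon\hat{\mathcal Y}\to\mathbb R^d$ and $c\colon\mathcal Y\to\mathbb R$ are functions; $\mathcal L^{\boldsymbol\rho}\in\mathbb R^{d\times N}$ is the matrix whose column indexed by $\hat y$ is $\boldsymbol\ell^{\boldsymbol\rho}(\hat y)$; and $\mathcal C=\mathrm{conv}(\{\boldsymbol\rho(y):y\in\mathcal Y\})$. $\mathrm{dom}(\Omega)=\{\boldsymbol\mu:\Omega(\boldsymbol\mu)<+\infty\}$ and $\Omega^*(\boldsymbol\theta)=\sup_{\boldsymbol\mu\in\mathbb R^d}\{\langle\boldsymbol\theta,\boldsymbol\mu\rangle-\Omega(\boldsymbol\mu)\}$ is the convex conjugate. The Fenchel--Young loss generated by $\Omega$ is $L_\Omega(\boldsymbol\theta,y)=\Omega^*(\boldsymbol\theta)+\Omega(\boldsymbol\rho(y))-\langle\boldsymbol\theta,\boldsymbol\rho(y)\rangle$. Define $\tau(\boldsymbol\mu)=-\min_{\hat y\in\hat{\mathcal Y}}\langle\boldsymbol\mu,\boldsymbol\ell^{\boldsymbol\rho}(\hat y)\rangle$ for $\boldsymbol\mu\in\mathbb R^d$ and $\Omega_\tau=\Omega+\tau$. The convolutional Fenchel--Young loss is the Fenchel--Young loss generated by $\Omega_\tau$: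 $L_{\Omega_\tau}(\boldsymbol\theta,y)=\Omega_\tau^*(\boldsymbol\theta)+\Omega_\tau(\boldsymbol\rho(y))-\langle\boldsymbol\theta,\boldsymbol\rho(y)\rangle$. *)

theory Defs
  imports "HOL-Analysis.Analysis" "HOL-Probability.Probability"
begin

text \<open>
  The finite label set, the finite prediction set and the index set of the coordinates of
  \<open>\<real>\<^sup>d\<close> are rendered as finite types \<open>'k\<close>, \<open>'n\<close> and \<open>'d\<close>. Functions into
  \<open>\<real> \<union> {+\<infinity>}\<close> are \<open>ereal\<close>-valued; the exclusion of \<open>-\<infinity>\<close> is a separate hypothesis
  wherever such a function occurs.
\<close>

definition prob_simplex :: "(real ^ 'n) set" where
  "prob_simplex = {p. (\<forall>i. 0 \<le> p $ i) \<and> (\<Sum>i\<in>UNIV. p $ i) = 1}"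

definition effective_domain :: "('a \<Rightarrow> ereal) \<Rightarrow> 'a set" where
  "effective_domain f = {x. f x < \<infinity>}"

definition convex_conjugate :: "('a::real_inner \<Rightarrow> ereal) \<Rightarrow> 'a \<Rightarrow> ereal" where
  "convex_conjugate f \<theta> = (SUP \<mu>. ereal (\<theta> \<bullet> \<mu>) - f \<mu>)"

text \<open>On \<open>real ^ 'd\<close> the norm below is the Euclidean one.\<close>

definition strongly_convex_on ::
    "real \<Rightarrow> ('a::real_normed_vector) set \<Rightarrow> ('a \<Rightarrow> ereal) \<Rightarrow> bool" where
  "strongly_convex_on lam C f \<longleftrightarrow> convex C \<and>
     (\<forall>x\<in>C. \<forall>y\<in>C. \<forall>t\<in>{0..1}.
        f (t *\<^sub>R x + (1 - t) *\<^sub>R y)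
          \<le> ereal t * f x + ereal (1 - t) * f y
            - ereal (lam / 2 * t * (1 - t) * (norm (x - y))\<^sup>2))"

definition fenchel_young_loss ::
    "('k \<Rightarrow> 'a::real_inner) \<Rightarrow> ('a \<Rightarrow> ereal) \<Rightarrow> 'a \<Rightarrow> 'k \<Rightarrow> ereal" where
  "fenchel_young_loss \<rho> \<Omega> \<theta> y =
     convex_conjugate \<Omega> \<theta> + \<Omega> (\<rho> y) - ereal (\<theta> \<bullet> \<rho> y)"

definition loss_matrix :: "('n \<Rightarrow> real ^ 'd) \<Rightarrow> real ^ 'n ^ 'd" where
  "loss_matrix l\<rho> = (\<chi> i yh. l\<rho> yh $ i)"

definition neg_min_loss :: "('n::finite \<Rightarrow> 'a::real_inner) \<Rightarrow> 'a \<Rightarrow> real" where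
  "neg_min_loss l\<rho> \<mu> = - (MIN yh. \<mu> \<bullet> l\<rho> yh)"

text \<open>The function \<open>\<Omega>\<^sub>\<tau> = \<Omega> + \<tau>\<close>, with \<open>\<tau> = neg_min_loss l\<rho>\<close>.\<close>

definition add_neg_min_loss ::
    "('n::finite \<Rightarrow> 'a::real_inner) \<Rightarrow> ('a \<Rightarrow> ereal) \<Rightarrow> 'a \<Rightarrow> ereal" where
  "add_neg_min_loss l\<rho> \<Omega> \<mu> = \<Omega> \<mu> + ereal (neg_min_loss l\<rho> \<mu>)"

definition conv_fenchel_young_loss ::
    "('k \<Rightarrow> 'a::real_inner) \<Rightarrow> ('n::finite \<Rightarrow> 'a) \<Rightarrow> ('a \<Rightarrow> ereal) \<Rightarrow> 'a \<Rightarrow> 'k \<Rightarrow> ereal" where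
  "conv_fenchel_young_loss \<rho> l\<rho> \<Omega> = fenchel_young_loss \<rho> (add_neg_min_loss l\<rho> \<Omega>)"

text \<open>
  The distribution with probability vector \<open>p\<close>. The constant \<open>embed_pmf\<close> is only specified for
  nonnegative functions of total mass one, i.e. for \<open>p\<close> in \<open>prob_simplex\<close>; the lemma below records
  that it then has the intended point masses.
\<close>

definition simplex_pmf :: "real ^ 'n \<Rightarrow> ('n::finite) pmf" where
  "simplex_pmf p = embed_pmf (\<lambda>i. p $ i)"

lemma pmf_simplex_pmf:
  fixes p :: "real ^ 'n"
  assumes "p \<in> prob_simplex"
  shows "pmf (simplex_pmf p) i = p $ i"
proof -
  have nonneg: "\<And>j. 0 \<le> p $ j" and total: "(\<Sum>j\<in>UNIV. p $ j) = 1"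
    using assms by (auto simp: prob_simplex_def)
  have "(\<integral>\<^sup>+ j. ennreal (p $ j) \<partial>count_space UNIV) = (\<Sum>j\<in>UNIV. ennreal (p $ j))"
    by (simp add: nn_integral_count_space_finite)
  also have "\<dots> = 1"
    using nonneg total by (simp add: sum_ennreal)
  finally show ?thesis
    unfolding simplex_pmf_def by (intro pmf_embed_pmf) (use nonneg in auto)
qed

end

theory Submission imports Defs begin

text \<open>
  The core is the duality \<open>\<Omega>\<^sub>\<tau>\<^sup>* \<theta> = min\<^bsub>p\<^esub> \<Omega>\<^sup>* (\<theta> + L p)\<close>, a minimax
  exchange. Since one player has finitely many pure strategies, it follows from separating a point
  from the set of payoff vectors, so no lower semicontinuity of \<open>\<Omega>\<close> is needed. The
  two conjugates in the claim are therefore equal; they are finite because a convex function is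
  bounded below on a polytope, so they cancel, and what remains is linear in the loss.
\<close>

text \<open>The centroid \<open>x0\<close> of \<open>S\<close> lies on a segment from any
  \<open>x\<close> in the hull to another hull point \<open>z\<close>, with weight
  \<open>1 / (2 * n)\<close> on \<open>x\<close> whatever \<open>x\<close> is. Since
  \<open>f z\<close> is at most the maximum \<open>b\<close> over the generators, a very negative
  \<open>f x\<close> would push \<open>f x0\<close> below its actual value.\<close>

lemma convex_on_polytope_bdd_below:
  fixes f :: "'a::real_vector \<Rightarrow> real"
  assumes "finite S" and f: "convex_on (convex hull S) f"
  shows "bdd_below (f ` (convex hull S))"
proof (cases "S = {}")
  case False
  define n where "n = real (card S)"
  have n: "n \<ge> 1"
    using False \<open>finite S\<close> by (simp add: n_def Suc_le_eq card_gt_0_iff)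
  define b where "b = Max (f ` S)"
  have b: "f x \<le> b" if "x \<in> convex hull S" for x
    using convex_on_convex_hull_bound[OF f, of b] that \<open>finite S\<close> by (auto simp: b_def)
  define x0 where "x0 = (\<Sum>s\<in>S. (1 / n) *\<^sub>R s)"
  have "2 * n * f x0 - (2 * n - 1) * b \<le> f x" if x: "x \<in> convex hull S" for x
  proof -
    obtain w where w: "\<And>s. s \<in> S \<Longrightarrow> 0 \<le> w s" "sum w S = 1" "x = (\<Sum>s\<in>S. w s *\<^sub>R s)"
      using x by (auto simp: convex_hull_finite[OF \<open>finite S\<close>])
    have w1: "w s \<le> 1" if "s \<in> S" for s
      using member_le_sum[of s S w] w that \<open>finite S\<close> by auto
    \<comment> \<open>The continuation of the segment from \<open>x\<close> through the centroid \<open>x0\<close>. The weights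
      \<open>1 - w s\<close> would do as well, except when \<open>S\<close> is a singleton.\<close>
    define z where "z = (\<Sum>s\<in>S. ((2 - w s) / (2 * n - 1)) *\<^sub>R s)"
    have z: "z \<in> convex hull S"
      unfolding convex_hull_finite[OF \<open>finite S\<close>] z_def
    proof (intro CollectI exI[of _ "\<lambda>s. (2 - w s) / (2 * n - 1)"] conjI ballI refl)
      show "0 \<le> (2 - w s) / (2 * n - 1)" if "s \<in> S" for s
        using w1[OF that] n by simp
      show "(\<Sum>s\<in>S. (2 - w s) / (2 * n - 1)) = 1"
        using w(2) n by (simp add: sum_divide_distrib[symmetric] sum_subtractf n_def)
    qed
    have "(1 - 1 / (2 * n)) * ((2 - u) / (2 * n - 1)) + (1 / (2 * n)) * u = 1 / n" for u
      using n by (simp add: divide_simps)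
    then have "x0 = (1 - 1 / (2 * n)) *\<^sub>R z + (1 / (2 * n)) *\<^sub>R x"
      unfolding x0_def z_def w(3)
      by (simp add: scaleR_sum_right sum.distrib[symmetric] scaleR_left_distrib[symmetric])
    then have "f x0 \<le> (1 - 1 / (2 * n)) * f z + 1 / (2 * n) * f x"
      using convex_onD[OF f, of "1 / (2 * n)" z x] x z n by simp
    also have "\<dots> \<le> (1 - 1 / (2 * n)) * b + 1 / (2 * n) * f x"
      using b[OF z] n by (intro add_right_mono mult_left_mono) auto
    finally have "2 * n * f x0 \<le> 2 * n * ((1 - 1 / (2 * n)) * b + 1 / (2 * n) * f x)"
      using n by (intro mult_left_mono) auto
    also have "\<dots> = (2 * n - 1) * b + f x"
      using n by (simp add: algebra_simps)
    finally show ?thesis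
      by simp
  qed
  then show ?thesis
    by (intro bdd_belowI2)
qed simp

text \<open>If no \<open>x\<close> secures \<open>v\<close> in every coordinate, a hyperplane
  separates the constant vector \<open>v\<close> from the payoff vectors, and its normalised normal
  is a mixed strategy that holds every \<open>x\<close> to at most \<open>v\<close>. Separation is
  only weak, hence the strict inequality in \<open>mixed\<close>.\<close>

lemma finite_minimax:
  fixes g :: "'n::finite \<Rightarrow> 'a::real_vector \<Rightarrow> real"
  assumes "C \<noteq> {}" and g: "\<And>i. concave_on C (g i)"
    and mixed: "\<And>p :: real ^ 'n. p \<in> prob_simplex \<Longrightarrow> \<exists>x\<in>C. v < (\<Sum>i\<in>UNIV. p $ i * g i x)"
  shows "\<exists>x\<in>C. \<forall>i. v \<le> g i x"
proof (rule ccontr)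
  assume no_pure: "\<not> ?thesis"
  \<comment> \<open>Closing the payoff vectors downwards makes the set convex, by concavity of each
    \<open>g i\<close>, and forces the normal of a separating hyperplane to be nonnegative.\<close>
  define A :: "(real ^ 'n) set" where "A = {a. \<exists>x\<in>C. \<forall>i. a $ i \<le> g i x}"
  have "convex C"
    using g concave_on_imp_convex by blast
  have "convex A"
  proof (rule convexI)
    fix a b :: "real ^ 'n" and s t :: real
    assume "a \<in> A" "b \<in> A" and st: "0 \<le> s" "0 \<le> t" "s + t = 1"
    then obtain x y where x: "x \<in> C" "\<And>i. a $ i \<le> g i x" and y: "y \<in> C" "\<And>i. b $ i \<le> g i y"
      by (auto simp: A_def)
    have "(s *\<^sub>R a + t *\<^sub>R b) $ i \<le> g i (s *\<^sub>R x + t *\<^sub>R y)" for i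
    proof -
      have "(s *\<^sub>R a + t *\<^sub>R b) $ i \<le> s * g i x + t * g i y"
        using x(2)[of i] y(2)[of i] st by (simp add: add_mono mult_left_mono)
      also have "\<dots> \<le> g i (s *\<^sub>R x + t *\<^sub>R y)"
        using g[of i] x(1) y(1) st by (simp add: concave_on_iff)
      finally show ?thesis .
    qed
    moreover have "s *\<^sub>R x + t *\<^sub>R y \<in> C"
      using \<open>convex C\<close> x(1) y(1) st by (simp add: convexD)
    ultimately show "s *\<^sub>R a + t *\<^sub>R b \<in> A"
      by (auto simp: A_def)
  qed
  moreover obtain x0 where x0: "x0 \<in> C"
    using \<open>C \<noteq> {}\<close> by blast
  then have a0: "(\<chi> i. g i x0) \<in> A"
    by (auto simp: A_def)
  moreover have "A \<inter> {\<chi> i. v} = {}"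
    using no_pure by (auto simp: A_def)
  ultimately obtain q \<beta> where "q \<noteq> 0" and qA: "\<And>a. a \<in> A \<Longrightarrow> q \<bullet> a \<le> \<beta>"
    and qv: "\<beta> \<le> q \<bullet> (\<chi> i. v)"
    using separating_hyperplane_sets[of A "{\<chi> i. v}"] by auto
  have q_nonneg: "0 \<le> q $ i" for i
  proof (rule ccontr)
    assume neg: "\<not> 0 \<le> q $ i"
    \<comment> \<open>Lowering coordinate \<open>i\<close> by \<open>s\<close> raises the inner
      product with \<open>q\<close> to at least \<open>\<beta> + 1\<close>, while
      \<open>s \<ge> 0\<close> keeps the point in \<open>A\<close>.\<close>
    define s where "s = max 0 ((\<beta> - q \<bullet> (\<chi> i. g i x0) + 1) / (- q $ i))"
    have "g j x0 - (s *\<^sub>R axis i 1) $ j \<le> g j x0" for j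
      by (simp add: s_def axis_def)
    then have "(\<chi> i. g i x0) - s *\<^sub>R axis i 1 \<in> A"
      unfolding A_def using x0 by (intro CollectI bexI[of _ x0]) auto
    from qA[OF this] have "q \<bullet> (\<chi> i. g i x0) + s * (- q $ i) \<le> \<beta>"
      by (simp add: inner_diff_right inner_axis)
    moreover have "(\<beta> - q \<bullet> (\<chi> i. g i x0) + 1) / (- q $ i) * (- q $ i) \<le> s * (- q $ i)"
      using neg by (intro mult_right_mono) (auto simp: s_def)
    moreover have "(\<beta> - q \<bullet> (\<chi> i. g i x0) + 1) / (- q $ i) * (- q $ i)
        = \<beta> - q \<bullet> (\<chi> i. g i x0) + 1"
      using neg by simp
    ultimately show False
      by linarith
  qed
  define m where "m = (\<Sum>i\<in>UNIV. q $ i)"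
  have "m \<noteq> 0"
    using \<open>q \<noteq> 0\<close> q_nonneg by (simp add: m_def sum_nonneg_eq_0_iff vec_eq_iff)
  then have m: "m > 0"
    using sum_nonneg[of UNIV "\<lambda>i. q $ i"] q_nonneg by (simp add: m_def less_le)
  have "(1 / m) *\<^sub>R q \<in> prob_simplex"
    using m q_nonneg by (simp add: prob_simplex_def sum_divide_distrib[symmetric] m_def)
  then obtain x where x: "x \<in> C" "v < (\<Sum>i\<in>UNIV. ((1 / m) *\<^sub>R q) $ i * g i x)"
    using mixed by blast
  have "(\<chi> i. g i x) \<in> A"
    using x(1) by (auto simp: A_def)
  then have "(\<Sum>i\<in>UNIV. q $ i * g i x) \<le> m * v"
    using qA qv by (fastforce simp: inner_vec_def m_def sum_distrib_right)
  moreover have "v < (\<Sum>i\<in>UNIV. q $ i * g i x) / m"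
    using x(2) by (simp add: sum_divide_distrib)
  ultimately show False
    using m by (simp add: pos_less_divide_eq mult.commute)
qed

lemma inner_loss_matrix_mult:
  "(loss_matrix l *v p) \<bullet> \<mu> = (\<Sum>i\<in>UNIV. p $ i * (\<mu> \<bullet> l i))"
proof -
  have "loss_matrix l *v p = (\<Sum>i\<in>UNIV. p $ i *\<^sub>R l i)"
    by (simp add: vec_eq_iff matrix_vector_mult_def loss_matrix_def mult.commute)
  then show ?thesis
    by (simp add: inner_sum_left inner_commute[of \<mu>])
qed

lemma MIN_le_prob_simplex_sum:
  fixes a :: "'n::finite \<Rightarrow> real"
  assumes "p \<in> prob_simplex"
  shows "(MIN i. a i) \<le> (\<Sum>i\<in>UNIV. p $ i * a i)"
proof -
  have "(\<Sum>i\<in>UNIV. p $ i * (MIN i. a i)) \<le> (\<Sum>i\<in>UNIV. p $ i * a i)"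
    using assms by (intro sum_mono mult_left_mono) (auto simp: prob_simplex_def)
  then show ?thesis
    using assms by (simp add: sum_distrib_right[symmetric] prob_simplex_def)
qed

text \<open>For \<le>, a minimum is at most any average, so the objectives of the two conjugates
  compare pointwise at every point of the simplex. Minimality of \<open>\<pi>\<close> enters only in
  \<ge>, where \<open>finite_minimax\<close> turns a bound for all mixtures into one
  \<open>\<mu>\<close> that serves all predictions.\<close>

lemma convex_conjugate_add_neg_min_loss:
  fixes \<Omega> :: "real ^ 'd \<Rightarrow> ereal" and l :: "'n::finite \<Rightarrow> real ^ 'd"
  assumes "C \<noteq> {}" and f: "convex_on C f"
    and \<Omega>: "\<And>\<mu>. \<Omega> \<mu> = (if \<mu> \<in> C then ereal (f \<mu>) else \<infinity>)"
    and \<pi>: "is_arg_min (\<lambda>p. convex_conjugate \<Omega> (\<theta> + loss_matrix l *v p))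
              (\<lambda>p. p \<in> prob_simplex) \<pi>"
  shows "convex_conjugate (add_neg_min_loss l \<Omega>) \<theta> = convex_conjugate \<Omega> (\<theta> + loss_matrix l *v \<pi>)"
proof (rule antisym)
  have "- neg_min_loss l \<mu> \<le> (loss_matrix l *v \<pi>) \<bullet> \<mu>" for \<mu>
    using MIN_le_prob_simplex_sum[of \<pi> "\<lambda>i. \<mu> \<bullet> l i"] \<pi>
    by (simp only: is_arg_min_def neg_min_loss_def minus_minus inner_loss_matrix_mult)
  then have "ereal (\<theta> \<bullet> \<mu>) - add_neg_min_loss l \<Omega> \<mu>
      \<le> ereal ((\<theta> + loss_matrix l *v \<pi>) \<bullet> \<mu>) - \<Omega> \<mu>" for \<mu>
    by (simp add: add_neg_min_loss_def \<Omega> inner_add_left minus_le_iff)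
  then show "convex_conjugate (add_neg_min_loss l \<Omega>) \<theta>
      \<le> convex_conjugate \<Omega> (\<theta> + loss_matrix l *v \<pi>)"
    unfolding convex_conjugate_def by (intro SUP_mono) auto
next
  \<comment> \<open>The payoff against prediction \<open>i\<close>: its average under
    \<open>p\<close> is the objective of the conjugate of \<open>\<Omega>\<close> at
    \<open>\<theta> + loss_matrix l *v p\<close>, and its minimum over \<open>i\<close> is the
    objective for \<Omega> + \<tau> at \<open>\<theta>\<close>.\<close>
  define g where "g i \<mu> = \<theta> \<bullet> \<mu> + \<mu> \<bullet> l i - f \<mu>" for i \<mu>
  show "convex_conjugate \<Omega> (\<theta> + loss_matrix l *v \<pi>)
      \<le> convex_conjugate (add_neg_min_loss l \<Omega>) \<theta>"
  proof (rule dense_le)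
    \<comment> \<open>Staying strictly below the supremum supplies the strict inequality that the
      minimax lemma requires, without the supremum being attained.\<close>
    fix v assume v: "v < convex_conjugate \<Omega> (\<theta> + loss_matrix l *v \<pi>)"
    show "v \<le> convex_conjugate (add_neg_min_loss l \<Omega>) \<theta>"
    proof (cases v)
      \<comment> \<open>Only real \<open>v\<close> needs an argument: \<infinity> is not strictly
        below anything, and -\<infinity> is below everything.\<close>
      case (real r)
      have "\<exists>\<mu>\<in>C. \<forall>i. r \<le> g i \<mu>"
      proof (rule finite_minimax)
        show "concave_on C (g i)" for i
          using f by (auto simp: concave_on_iff convex_on_def g_def algebra_simps inner_add_right)
        fix p :: "real ^ 'n"
        assume p: "p \<in> prob_simplex"
        then have "v < convex_conjugate \<Omega> (\<theta> + loss_matrix l *v p)"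
          using v \<pi> by (auto simp: is_arg_min_def not_less intro: less_le_trans)
        then obtain \<mu> where "v < ereal ((\<theta> + loss_matrix l *v p) \<bullet> \<mu>) - \<Omega> \<mu>"
          by (auto simp: convex_conjugate_def less_SUP_iff)
        then have "\<mu> \<in> C" and "r < (\<theta> + loss_matrix l *v p) \<bullet> \<mu> - f \<mu>"
          by (auto simp: \<Omega> real split: if_splits)
        moreover have "(\<Sum>i\<in>UNIV. p $ i * g i \<mu>) = (\<theta> + loss_matrix l *v p) \<bullet> \<mu> - f \<mu>"
        proof -
          have "(\<Sum>i\<in>UNIV. p $ i * g i \<mu>)
              = (\<Sum>i\<in>UNIV. p $ i * (\<theta> \<bullet> \<mu> - f \<mu>)) + (\<Sum>i\<in>UNIV. p $ i * (\<mu> \<bullet> l i))"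
            by (simp add: g_def sum.distrib[symmetric] algebra_simps)
          then show ?thesis
            using p by (simp add: sum_distrib_right[symmetric] prob_simplex_def inner_add_left
                inner_loss_matrix_mult)
        qed
        ultimately show "\<exists>\<mu>\<in>C. r < (\<Sum>i\<in>UNIV. p $ i * g i \<mu>)"
          by (intro bexI[of _ \<mu>]) simp_all
      qed fact
      then obtain \<mu> where \<mu>: "\<mu> \<in> C" "\<And>i. r \<le> g i \<mu>"
        by blast
      have "r - \<theta> \<bullet> \<mu> + f \<mu> \<le> (MIN i. \<mu> \<bullet> l i)"
        using \<mu>(2) by (intro Min.boundedI) (auto simp: g_def algebra_simps)
      then have "r \<le> \<theta> \<bullet> \<mu> - (f \<mu> + neg_min_loss l \<mu>)"
        unfolding neg_min_loss_def by linarith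
      then have "v \<le> ereal (\<theta> \<bullet> \<mu>) - add_neg_min_loss l \<Omega> \<mu>"
        using \<mu>(1) by (simp add: real \<Omega> add_neg_min_loss_def)
      also have "\<dots> \<le> convex_conjugate (add_neg_min_loss l \<Omega>) \<theta>"
        unfolding convex_conjugate_def by (rule SUP_upper) simp
      finally show ?thesis .
    qed (use v in auto)
  qed
qed

text \<open>Cauchy-Schwarz and the lower bound on \<open>f\<close> bound the supremum above; any
  single point of \<open>C\<close> bounds it below.\<close>

lemma convex_conjugate_finite:
  fixes \<Omega> :: "'a::real_inner \<Rightarrow> ereal"
  assumes "C \<noteq> {}" "bounded C" "bdd_below (f ` C)"
    and \<Omega>: "\<And>\<mu>. \<Omega> \<mu> = (if \<mu> \<in> C then ereal (f \<mu>) else \<infinity>)"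
  shows "\<bar>convex_conjugate \<Omega> \<eta>\<bar> \<noteq> \<infinity>"
proof -
  obtain B where B: "\<And>\<mu>. \<mu> \<in> C \<Longrightarrow> norm \<mu> \<le> B"
    using \<open>bounded C\<close> by (auto simp: bounded_iff)
  obtain b where b: "\<And>\<mu>. \<mu> \<in> C \<Longrightarrow> b \<le> f \<mu>"
    using \<open>bdd_below (f ` C)\<close> by (auto simp: bdd_below_def)
  have "\<eta> \<bullet> \<mu> - f \<mu> \<le> norm \<eta> * B - b" if "\<mu> \<in> C" for \<mu>
    using b[OF that] norm_cauchy_schwarz[of \<eta> \<mu>] mult_left_mono[OF B[OF that], of "norm \<eta>"]
    by simp
  then have "convex_conjugate \<Omega> \<eta> \<le> ereal (norm \<eta> * B - b)"
    unfolding convex_conjugate_def by (intro SUP_least) (simp add: \<Omega>)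
  moreover obtain \<mu> where "\<mu> \<in> C"
    using \<open>C \<noteq> {}\<close> by blast
  then have "ereal (\<eta> \<bullet> \<mu> - f \<mu>) \<le> convex_conjugate \<Omega> \<eta>"
    unfolding convex_conjugate_def by (intro SUP_upper2[of \<mu>]) (simp_all add: \<Omega>)
  ultimately show ?thesis
    by (cases "convex_conjugate \<Omega> \<eta>") auto
qed

lemma expectation_simplex_pmf:
  fixes a :: "'n::finite \<Rightarrow> real"
  assumes "p \<in> prob_simplex"
  shows "measure_pmf.expectation (simplex_pmf p) a = (\<Sum>i\<in>UNIV. p $ i * a i)"
  using assms by (simp add: integral_measure_pmf[of UNIV] pmf_simplex_pmf)

theorem lemma4p3:
  fixes ell :: "'n::finite \<Rightarrow> 'k::finite \<Rightarrow> real"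
    and \<rho> :: "'k \<Rightarrow> real ^ 'd"
    and l\<rho> :: "'n \<Rightarrow> real ^ 'd"
    and c :: "'k \<Rightarrow> real"
    and \<Omega> :: "real ^ 'd \<Rightarrow> ereal"
    and lam :: real
    and \<theta> :: "real ^ 'd"
    and y :: 'k
    and \<pi> :: "real ^ 'n"
  assumes ell_nonneg: "\<And>yh y. 0 \<le> ell yh y"
    and ell_decomp: "\<And>yh y. ell yh y = \<rho> y \<bullet> l\<rho> yh + c y"
    and ell_min: "\<And>y. (MIN yh. ell yh y) = 0"
    and Omega_not_MInf: "\<And>\<mu>. \<Omega> \<mu> \<noteq> -\<infinity>"
    and Omega_dom: "effective_domain \<Omega> = convex hull (range \<rho>)"
    and lam_pos: "lam > 0"
    and Omega_strongly_convex: "strongly_convex_on lam (convex hull (range \<rho>)) \<Omega>"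
    and pi_argmin: "is_arg_min (\<lambda>p. convex_conjugate \<Omega> (\<theta> + loss_matrix l\<rho> *v p))
                      (\<lambda>p. p \<in> prob_simplex) \<pi>"
  shows "ereal (measure_pmf.expectation (simplex_pmf \<pi>) (\<lambda>yh. ell yh y)) =
           conv_fenchel_young_loss \<rho> l\<rho> \<Omega> \<theta> y
           - fenchel_young_loss \<rho> \<Omega> (\<theta> + loss_matrix l\<rho> *v \<pi>) y"
proof -
  define C where "C = convex hull (range \<rho>)"
  \<comment> \<open>A real-valued representative of \<open>\<Omega>\<close>, faithful on
    \<open>C\<close>. Outside \<open>C\<close> it takes the default value 0, so
    \<open>\<Omega>\<close> is always recovered through a case split on membership.\<close>
  define f where "f \<mu> = real_of_ereal (\<Omega> \<mu>)" for \<mu>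
  have \<rho>C: "\<rho> y \<in> C"
    unfolding C_def by (rule hull_inc) simp
  then have "C \<noteq> {}"
    by blast
  have dom: "\<Omega> \<mu> < \<infinity> \<longleftrightarrow> \<mu> \<in> C" for \<mu>
    using Omega_dom by (auto simp: effective_domain_def C_def)
  have \<Omega>: "\<Omega> \<mu> = (if \<mu> \<in> C then ereal (f \<mu>) else \<infinity>)" for \<mu>
    using dom[of \<mu>] Omega_not_MInf[of \<mu>] by (cases "\<Omega> \<mu>") (auto simp: f_def)
  have f: "convex_on C f"
  proof (rule convex_onI)
    show "convex C"
      by (simp add: C_def)
    fix t :: real and x z
    assume t: "0 < t" "t < 1" and xz: "x \<in> C" "z \<in> C"
    have "(1 - t) *\<^sub>R x + t *\<^sub>R z \<in> C"
      using \<open>convex C\<close> xz t by (simp add: convexD)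
    \<comment> \<open>\<open>convex_onI\<close> puts weight \<open>1 - t\<close> on the first point,
      so strong convexity is instantiated at \<open>1 - t\<close>; the term
      \<open>1 - (1 - t)\<close> is left unsimplified to match.\<close>
    moreover have "\<Omega> ((1 - t) *\<^sub>R x + (1 - (1 - t)) *\<^sub>R z)
        \<le> ereal (1 - t) * \<Omega> x + ereal (1 - (1 - t)) * \<Omega> z
          - ereal (lam / 2 * (1 - t) * (1 - (1 - t)) * (norm (x - z))\<^sup>2)"
      using Omega_strongly_convex xz t unfolding strongly_convex_on_def C_def
      by (elim conjE) (drule (1) bspec, drule (1) bspec, erule bspec, simp)
    ultimately have "f ((1 - t) *\<^sub>R x + t *\<^sub>R z)
        \<le> (1 - t) * f x + t * f z - lam / 2 * (1 - t) * t * (norm (x - z))\<^sup>2"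
      using xz by (simp add: \<Omega>)
    moreover have "0 \<le> lam / 2 * (1 - t) * t * (norm (x - z))\<^sup>2"
      using lam_pos t by simp
    ultimately show "f ((1 - t) *\<^sub>R x + t *\<^sub>R z) \<le> (1 - t) * f x + t * f z"
      by linarith
  qed
  have "bdd_below (f ` C)"
    using f unfolding C_def by (intro convex_on_polytope_bdd_below) auto
  moreover have "bounded C"
    by (simp add: C_def finite_imp_bounded bounded_convex_hull)
  \<comment> \<open>Finiteness is what lets the common conjugate cancel: in \<open>ereal\<close>,
    \<infinity> - \<infinity> is not 0.\<close>
  ultimately have "\<bar>convex_conjugate \<Omega> (\<theta> + loss_matrix l\<rho> *v \<pi>)\<bar> \<noteq> \<infinity>"
    by (intro convex_conjugate_finite[OF \<open>C \<noteq> {}\<close> _ _ \<Omega>])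
  then obtain r where r: "convex_conjugate \<Omega> (\<theta> + loss_matrix l\<rho> *v \<pi>) = ereal r"
    by (cases rule: ereal_cases) auto
  \<comment> \<open>The zero minimum of the loss determines \<tau> at \<open>\<rho> y\<close>: the
    least inner product there is \<open>- c y\<close>.\<close>
  have "(MIN yh. \<rho> y \<bullet> l\<rho> yh + c y) = (MIN yh. \<rho> y \<bullet> l\<rho> yh) + c y"
    by (intro Min_add_commute) auto
  then have \<tau>: "neg_min_loss l\<rho> (\<rho> y) = c y"
    using ell_min[of y] by (simp add: ell_decomp neg_min_loss_def del: minus_Min_eq_Max)
  have \<pi>: "\<pi> \<in> prob_simplex"
    using pi_argmin by (simp add: is_arg_min_def)
  have "measure_pmf.expectation (simplex_pmf \<pi>) (\<lambda>yh. ell yh y)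
      = (\<Sum>i\<in>UNIV. \<pi> $ i * (\<rho> y \<bullet> l\<rho> i)) + (\<Sum>i\<in>UNIV. \<pi> $ i) * c y"
    by (simp add: expectation_simplex_pmf[OF \<pi>] ell_decomp distrib_left sum.distrib
        sum_distrib_right)
  also have "\<dots> = (loss_matrix l\<rho> *v \<pi>) \<bullet> \<rho> y + c y"
    using \<pi> by (simp add: inner_loss_matrix_mult prob_simplex_def)
  finally have "measure_pmf.expectation (simplex_pmf \<pi>) (\<lambda>yh. ell yh y)
      = (loss_matrix l\<rho> *v \<pi>) \<bullet> \<rho> y + c y" .
  \<comment> \<open>Both conjugates equal \<open>r\<close> and \<open>\<Omega> (\<rho> y)\<close> is
    finite, so what survives on the right is \<tau> at \<open>\<rho> y\<close>, namely
    \<open>c y\<close>, plus the inner product of \<open>loss_matrix l\<rho> *v \<pi>\<close> with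
    \<open>\<rho> y\<close>.\<close>
  then show ?thesis
    using \<rho>C by (simp add: conv_fenchel_young_loss_def fenchel_young_loss_def r \<tau> \<Omega>
        convex_conjugate_add_neg_min_loss[OF \<open>C \<noteq> {}\<close> f \<Omega> pi_argmin] add_neg_min_loss_def
        inner_add_left)
qed

end
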